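(* Let $k\ge 1$ and let $d=(d_1,d_2,\dots,d_k)$ be an increasing sequence of positive integers, $d_1<d_2<\dots<d_k$. Then there exists a compact convex set $C\subset\mathbb{R}^{d_k}$ whose pattern of facial dimensions is $d$, that is, the set of dimensions of the faces of $C$ having positive dimension is exactly $\{d_1,d_2,\dots,d_k\}$: for every positive integer $j$, the set $C$ has a face of dimension $j$ if and only if $j\in\{d_1,\dots,d_k\}$.
   Context: A face $F$ of a closed convex set $C\subset\mathbb{R}^n$ is a closed convex subset $F\subset C$ such that for any point $x\in F$ and any line segment $[a,b]\subset C$ with $x\in(a,b)$ (the open segment between $a$ and $b$), we have $a,b\in F$. Faces are not required to be exposed (i.e. to be intersections of $C$ with a supporting hyperplane), and $C$ itself is counted as a face of $C$. The dimension of a convex set (in particular, of a face) is the dimension of its affine hull. The pattern of facial dimensions of a compact convex set is the increasing sequence of all positive integers that occur as dimensions of its faces (zero-dimensional faces, i.e. extreme points, always exist for a nonempty compact convex set and are not recorded in the pattern). *)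

theory Defs
  imports "HOL-Analysis.Analysis"
begin

text \<open>
  The library relation \<^const>\<open>face_of\<close> does not ask a face to be closed, so closedness is
  required explicitly here. The positive dimensions occurring among the closed faces of a
  convex set form its pattern of facial dimensions; since an increasing sequence is determined
  by its set of terms, the pattern is represented by that set. Note that \<^const>\<open>aff_dim\<close>
  takes the value \<open>-1\<close> on the empty face, which is therefore not recorded.
\<close>

definition facial_dimension_pattern :: "'a::euclidean_space set \<Rightarrow> nat set" where
  "facial_dimension_pattern C =
     {j. 0 < j \<and> (\<exists>F. closed F \<and> F face_of C \<and> aff_dim F = int j)}"

end

theory Submission
  imports Defs
begin

text \<open>
  The pattern is built up one dimension at a time, smallest first, and everything rests on the
  passage from one dimension to the next. Given a nonempty compact convex set \<open>K\<close> in a hyperplane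
  \<open>u \<bullet> x = 0\<close> of a subspace \<open>U\<close>, of any dimension, there is a compact convex set \<open>C\<close> of full dimension
  in \<open>U\<close> with \<open>K\<close> as a face and with no proper faces other than single points and the faces of \<open>K\<close>. The
  pattern of \<open>C\<close> is then that of \<open>K\<close> with \<open>dim U\<close> added (\<open>facial_dimension_pattern_thicken\<close>), and
  induction on the set of dimensions finishes the proof (\<open>pattern_realizable_in_subspace\<close>).

  For \<open>C\<close> (\<open>thicken\<close> intersected with \<open>U\<close>), with \<open>u \<noteq> 0\<close> in \<open>U\<close> and \<open>K\<close> in the open ball of radius
  \<open>r\<close> about \<open>0\<close>, take the points \<open>w\<close> of \<open>U\<close> that satisfy \<open>u \<bullet> w \<ge> 0\<close>, \<open>|w| \<le> r\<close> and
  \<open>dist(w, K)\<^sup>2 \<le> (u \<bullet> w) (r\<^sup>2 - |w|\<^sup>2)\<close>. On the hyperplane \<open>u \<bullet> w = 0\<close> the last inequality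
  forces \<open>w \<in> K\<close>, so \<open>K\<close> is the face cut out by this supporting hyperplane. Away from the hyperplane
  \<open>C\<close> is strictly convex: the distance to \<open>K\<close> is convex, the geometric mean of the concave functions
  \<open>u \<bullet> w\<close> and \<open>r\<^sup>2 - |w|\<^sup>2\<close> is concave, and since \<open>r\<^sup>2 - |w|\<^sup>2\<close> is strictly concave, every inequality
  is strict at the interior points of a segment in \<open>C\<close> that is not contained in the hyperplane
  (\<open>open_segment_thicken\<close>). Such a segment thus enters the relative interior of \<open>C\<close>, so a face
  containing it is \<open>C\<close> itself. Every other face is a single point or lies in \<open>K\<close>.
\<close>

section \<open>Two convexity inequalities\<close>

lemma infdist_convex_combination_le:
  fixes K :: "'a::euclidean_space set"
  assumes "closed K" "convex K" "K \<noteq> {}" "0 \<le> \<alpha>" "0 \<le> \<beta>" "\<alpha> + \<beta> = 1"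
  shows "infdist (\<alpha> *\<^sub>R a + \<beta> *\<^sub>R b) K \<le> \<alpha> * infdist a K + \<beta> * infdist b K"
proof -
  obtain p where p: "p \<in> K" "infdist a K = dist a p"
    using infdist_attains_inf[OF assms(1,3)] by metis
  obtain q where q: "q \<in> K" "infdist b K = dist b q"
    using infdist_attains_inf[OF assms(1,3)] by metis
  have "\<alpha> *\<^sub>R p + \<beta> *\<^sub>R q \<in> K"
    using convexD[OF assms(2)] p q assms by blast
  then have "infdist (\<alpha> *\<^sub>R a + \<beta> *\<^sub>R b) K \<le> dist (\<alpha> *\<^sub>R a + \<beta> *\<^sub>R b) (\<alpha> *\<^sub>R p + \<beta> *\<^sub>R q)"
    by (rule infdist_le)
  also have "\<dots> = norm (\<alpha> *\<^sub>R (a - p) + \<beta> *\<^sub>R (b - q))"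
    by (simp add: dist_norm algebra_simps)
  also have "\<dots> \<le> \<alpha> * dist a p + \<beta> * dist b q"
    using assms by (intro norm_triangle_le) (simp add: dist_norm)
  finally show ?thesis using p q by simp
qed

text \<open>This is the concavity of the geometric mean, stated without square roots.\<close>

lemma convex_combination_square_le:
  fixes x y s t p q \<alpha> \<beta> :: real
  assumes "0 \<le> x" "0 \<le> y" "0 \<le> s" "0 \<le> t" "0 \<le> p" "0 \<le> q" "0 \<le> \<alpha>" "0 \<le> \<beta>"
    and x: "x\<^sup>2 \<le> s * p" and y: "y\<^sup>2 \<le> t * q"
  shows "(\<alpha> * x + \<beta> * y)\<^sup>2 \<le> (\<alpha> * s + \<beta> * t) * (\<alpha> * p + \<beta> * q)"
proof -
  \<comment> \<open>The cross term is bounded by the inequality of the arithmetic and geometric mean.\<close>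
  have "(x * y)\<^sup>2 \<le> (s * p) * (t * q)"
    unfolding power_mult_distrib using x y by (intro mult_mono) (use assms in auto)
  moreover have "4 * ((s * q) * (t * p)) \<le> (s * q + t * p)\<^sup>2"
    using zero_le_power2[of "s * q - t * p"] by (simp add: power2_eq_square algebra_simps)
  ultimately have "(2 * (x * y))\<^sup>2 \<le> (s * q + t * p)\<^sup>2"
    by (simp add: power_mult_distrib algebra_simps)
  then have xy: "2 * (x * y) \<le> s * q + t * p"
    by (rule power2_le_imp_le) (use assms in auto)
  have "(\<alpha> * x + \<beta> * y)\<^sup>2 = \<alpha>\<^sup>2 * x\<^sup>2 + \<beta>\<^sup>2 * y\<^sup>2 + (\<alpha> * \<beta>) * (2 * (x * y))"
    by (simp add: power2_eq_square algebra_simps)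
  also have "\<dots> \<le> \<alpha>\<^sup>2 * (s * p) + \<beta>\<^sup>2 * (t * q) + (\<alpha> * \<beta>) * (s * q + t * p)"
    by (intro add_mono mult_left_mono x y xy) (use assms in auto)
  also have "\<dots> = (\<alpha> * s + \<beta> * t) * (\<alpha> * p + \<beta> * q)"
    by (simp add: power2_eq_square algebra_simps)
  finally show ?thesis .
qed

section \<open>Thickening a compact convex set\<close>

definition thicken :: "'a::euclidean_space \<Rightarrow> real \<Rightarrow> 'a set \<Rightarrow> 'a set" where
  "thicken u r K = {w. 0 \<le> u \<bullet> w \<and> 0 \<le> r\<^sup>2 - (norm w)\<^sup>2 \<and>
     (infdist w K)\<^sup>2 \<le> (u \<bullet> w) * (r\<^sup>2 - (norm w)\<^sup>2)}"

definition open_thicken :: "'a::euclidean_space \<Rightarrow> real \<Rightarrow> 'a set \<Rightarrow> 'a set" where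
  "open_thicken u r K = {w. 0 < u \<bullet> w \<and> 0 < r\<^sup>2 - (norm w)\<^sup>2 \<and>
     (infdist w K)\<^sup>2 < (u \<bullet> w) * (r\<^sup>2 - (norm w)\<^sup>2)}"

lemma open_thicken_subset_thicken: "open_thicken u r K \<subseteq> thicken u r K"
  by (auto simp: open_thicken_def thicken_def)

lemma open_open_thicken: "open (open_thicken u r K)"
  unfolding open_thicken_def
  by (intro open_Collect_conj open_Collect_less continuous_intros)

lemma compact_thicken: "compact (thicken u r K)"
proof -
  have "closed (thicken u r K)"
    unfolding thicken_def
    by (intro closed_Collect_conj closed_Collect_le continuous_intros)
  moreover have "thicken u r K \<subseteq> cball 0 \<bar>r\<bar>"
    by (auto simp: thicken_def abs_le_square_iff[symmetric])
  ultimately show ?thesis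
    by (meson bounded_cball bounded_subset compact_eq_bounded_closed)
qed

text \<open>The last term on the right makes \<open>r\<^sup>2 - |w|\<^sup>2\<close> strictly concave.\<close>

lemma norm_convex_combination_square:
  fixes a b :: "'a::real_inner"
  assumes "\<alpha> + \<beta> = 1"
  shows "r\<^sup>2 - (norm (\<alpha> *\<^sub>R a + \<beta> *\<^sub>R b))\<^sup>2
       = \<alpha> * (r\<^sup>2 - (norm a)\<^sup>2) + \<beta> * (r\<^sup>2 - (norm b)\<^sup>2) + \<alpha> * \<beta> * (norm (a - b))\<^sup>2"
proof -
  have \<beta>: "\<beta> = 1 - \<alpha>" using assms by simp
  show ?thesis
    unfolding power2_norm_eq_inner \<beta>
    by (simp add: inner_simps inner_commute algebra_simps)
qed

text \<open>
  The bound has the weighted mean of \<open>r\<^sup>2 - |a|\<^sup>2\<close> and \<open>r\<^sup>2 - |b|\<^sup>2\<close> on its right-hand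
  side; replacing it by the value at the combination itself leaves a gain, which gives convexity
  of the thickening and its strict convexity off the hyperplane.
\<close>

lemma infdist_square_convex_combination_le:
  assumes "closed K" "convex K" "K \<noteq> {}"
    and "a \<in> thicken u r K" "b \<in> thicken u r K" "0 \<le> \<alpha>" "0 \<le> \<beta>" "\<alpha> + \<beta> = 1"
  shows "(infdist (\<alpha> *\<^sub>R a + \<beta> *\<^sub>R b) K)\<^sup>2
       \<le> (u \<bullet> (\<alpha> *\<^sub>R a + \<beta> *\<^sub>R b)) * (\<alpha> * (r\<^sup>2 - (norm a)\<^sup>2) + \<beta> * (r\<^sup>2 - (norm b)\<^sup>2))"
proof -
  have "(infdist (\<alpha> *\<^sub>R a + \<beta> *\<^sub>R b) K)\<^sup>2 \<le> (\<alpha> * infdist a K + \<beta> * infdist b K)\<^sup>2"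
    using infdist_convex_combination_le[OF assms(1-3,6-8)]
    by (simp add: infdist_nonneg power_mono)
  also have "\<dots> \<le> (\<alpha> * (u \<bullet> a) + \<beta> * (u \<bullet> b))
      * (\<alpha> * (r\<^sup>2 - (norm a)\<^sup>2) + \<beta> * (r\<^sup>2 - (norm b)\<^sup>2))"
    using assms
    by (intro convex_combination_square_le) (auto simp: thicken_def infdist_nonneg)
  finally show ?thesis by (simp add: inner_simps)
qed

lemma convex_thicken:
  assumes "closed K" "convex K" "K \<noteq> {}"
  shows "convex (thicken u r K)"
proof (rule convexI)
  fix a b and \<alpha> \<beta> :: real
  assume a: "a \<in> thicken u r K" and b: "b \<in> thicken u r K"
    and \<alpha>\<beta>: "0 \<le> \<alpha>" "0 \<le> \<beta>" "\<alpha> + \<beta> = 1"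
  let ?z = "\<alpha> *\<^sub>R a + \<beta> *\<^sub>R b"
  let ?m = "\<alpha> * (r\<^sup>2 - (norm a)\<^sup>2) + \<beta> * (r\<^sup>2 - (norm b)\<^sup>2)"
  have m: "?m \<le> r\<^sup>2 - (norm ?z)\<^sup>2"
    unfolding norm_convex_combination_square[OF \<alpha>\<beta>(3)] using \<alpha>\<beta> by simp
  have m0: "0 \<le> ?m" using a b \<alpha>\<beta> by (simp add: thicken_def)
  have u0: "0 \<le> u \<bullet> ?z" using a b \<alpha>\<beta> by (simp add: thicken_def inner_simps)
  have "(infdist ?z K)\<^sup>2 \<le> (u \<bullet> ?z) * ?m"
    by (rule infdist_square_convex_combination_le[OF assms a b \<alpha>\<beta>])
  also have "\<dots> \<le> (u \<bullet> ?z) * (r\<^sup>2 - (norm ?z)\<^sup>2)"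
    using m u0 by (rule mult_left_mono)
  finally show "?z \<in> thicken u r K"
    using u0 order_trans[OF m0 m] by (simp add: thicken_def)
qed

text \<open>
  One endpoint off the hyperplane is enough: \<open>u \<bullet> z\<close> is then positive inside the segment, and the
  strict gain in \<open>r\<^sup>2 - |z|\<^sup>2\<close> is not lost in the product.
\<close>

lemma open_segment_thicken:
  assumes "closed K" "convex K" "K \<noteq> {}"
    and a: "a \<in> thicken u r K" and b: "b \<in> thicken u r K" and "0 < u \<bullet> a"
  shows "open_segment a b \<subseteq> open_thicken u r K"
proof
  fix z assume "z \<in> open_segment a b"
  then obtain \<beta> where "a \<noteq> b" "0 < \<beta>" "\<beta> < 1" "z = (1 - \<beta>) *\<^sub>R a + \<beta> *\<^sub>R b"
    by (auto simp: in_segment)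
  then obtain \<alpha> where \<alpha>\<beta>: "0 < \<alpha>" "0 < \<beta>" "\<alpha> + \<beta> = 1"
    and z: "z = \<alpha> *\<^sub>R a + \<beta> *\<^sub>R b"
    by (metis diff_add_cancel diff_gt_0_iff_gt)
  let ?m = "\<alpha> * (r\<^sup>2 - (norm a)\<^sup>2) + \<beta> * (r\<^sup>2 - (norm b)\<^sup>2)"
  have m: "?m < r\<^sup>2 - (norm z)\<^sup>2"
    unfolding z norm_convex_combination_square[OF \<alpha>\<beta>(3)] using \<alpha>\<beta> \<open>a \<noteq> b\<close> by simp
  have m0: "0 \<le> ?m" using a b \<alpha>\<beta> by (simp add: thicken_def)
  have u0: "0 < u \<bullet> z"
    using b \<alpha>\<beta> \<open>0 < u \<bullet> a\<close> by (simp add: z thicken_def inner_simps add_pos_nonneg)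
  have "(infdist z K)\<^sup>2 \<le> (u \<bullet> z) * ?m"
    unfolding z using \<alpha>\<beta> by (intro infdist_square_convex_combination_le[OF assms(1-3) a b]) auto
  also have "\<dots> < (u \<bullet> z) * (r\<^sup>2 - (norm z)\<^sup>2)"
    using m u0 by (rule mult_strict_left_mono)
  finally show "z \<in> open_thicken u r K"
    using u0 order_le_less_trans[OF m0 m] by (simp add: open_thicken_def)
qed

text \<open>
  On the hyperplane the bound for the distance to \<open>K\<close> vanishes, and \<open>K\<close> is closed.
\<close>

lemma thicken_Int_hyperplane:
  assumes "closed K" "K \<noteq> {}" "K \<subseteq> ball 0 r" "K \<subseteq> {x. u \<bullet> x = 0}"
  shows "thicken u r K \<inter> {x. u \<bullet> x = 0} = K"
proof
  have "x \<in> K" if "x \<in> thicken u r K" "u \<bullet> x = 0" for x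
    using that assms(1,2) by (auto simp: thicken_def in_closed_iff_infdist_zero)
  then show "thicken u r K \<inter> {x. u \<bullet> x = 0} \<subseteq> K" by blast
  have "x \<in> thicken u r K" if "x \<in> K" for x
    using that assms(3,4) by (force simp: thicken_def intro: power_mono)
  then show "K \<subseteq> thicken u r K \<inter> {x. u \<bullet> x = 0}" using assms(4) by blast
qed

text \<open>
  Moving from a point of \<open>K\<close> in the direction \<open>u\<close> by \<open>e\<close>, the squared distance to \<open>K\<close> is
  quadratic in \<open>e\<close>, while the bound for it grows linearly.
\<close>

lemma open_thicken_nonempty:
  assumes "x \<in> K" "norm x < r" "u \<bullet> x = 0" "u \<noteq> 0"
  obtains e where "x + e *\<^sub>R u \<in> open_thicken u r K"
proof -
  let ?f = "\<lambda>e. r\<^sup>2 - (norm (x + e *\<^sub>R u))\<^sup>2 - e"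
  have "(?f \<longlongrightarrow> ?f 0) (at_right 0)" by (intro tendsto_intros)
  moreover have "0 < ?f 0" using assms(2) by (simp add: power_strict_mono)
  ultimately have "eventually (\<lambda>e. 0 < ?f e) (at_right 0)"
    by (rule order_tendstoD(1))
  then have "eventually (\<lambda>e. 0 < e \<and> 0 < ?f e) (at_right 0)"
    using eventually_at_right_less[of "0::real"] by eventually_elim simp
  then obtain e where e: "0 < e" "0 < ?f e"
    using eventually_happens trivial_limit_at_right_real by blast
  let ?w = "x + e *\<^sub>R u"
  have uw: "u \<bullet> ?w = e * (norm u)\<^sup>2"
    using assms(3) by (simp add: inner_simps power2_norm_eq_inner)
  have "infdist ?w K \<le> e * norm u"
    using infdist_le[OF assms(1), of ?w] e by (simp add: dist_norm)
  then have "(infdist ?w K)\<^sup>2 \<le> (e * norm u)\<^sup>2"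
    by (simp add: infdist_nonneg power_mono)
  also have "\<dots> = (u \<bullet> ?w) * e"
    by (simp add: uw power2_eq_square)
  also have "\<dots> < (u \<bullet> ?w) * (r\<^sup>2 - (norm ?w)\<^sup>2)"
    using e assms(4) by (intro mult_strict_left_mono) (auto simp: uw)
  finally have "?w \<in> open_thicken u r K"
    using e assms(4) by (simp add: open_thicken_def uw)
  then show thesis by (rule that)
qed

section \<open>Faces of the thickening\<close>

text \<open>
  The subspace \<open>U\<close> contains the affine hull of \<open>U \<inter> thicken u r K\<close>, so a subset of it that is
  relatively open in \<open>U\<close> is relatively open in that affine hull.
\<close>

lemma open_thicken_subset_rel_interior:
  assumes "subspace U"
  shows "U \<inter> open_thicken u r K \<subseteq> rel_interior (U \<inter> thicken u r K)"
proof
  fix x assume x: "x \<in> U \<inter> open_thicken u r K"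
  have "affine hull (U \<inter> thicken u r K) \<subseteq> U"
    using assms by (simp add: hull_minimal subspace_imp_affine)
  then have "open_thicken u r K \<inter> affine hull (U \<inter> thicken u r K) \<subseteq> U \<inter> thicken u r K"
    using open_thicken_subset_thicken by blast
  then show "x \<in> rel_interior (U \<inter> thicken u r K)"
    using x open_thicken_subset_thicken[of u r K] open_open_thicken[of u r K]
    unfolding mem_rel_interior by (intro exI[of _ "open_thicken u r K"]) blast
qed

lemma aff_dim_thicken:
  assumes "subspace U" "u \<in> U" "u \<noteq> 0" "x \<in> K" "x \<in> U" "norm x < r" "u \<bullet> x = 0"
  shows "aff_dim (U \<inter> thicken u r K) = int (dim U)"
proof -
  obtain e where "x + e *\<^sub>R u \<in> open_thicken u r K"
    using open_thicken_nonempty[OF assms(4,6,7,3)] .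
  moreover have "x + e *\<^sub>R u \<in> U"
    using assms by (simp add: subspace_add subspace_scale)
  ultimately have "U \<inter> open_thicken u r K \<noteq> {}" by blast
  then have "aff_dim (U \<inter> open_thicken u r K) = aff_dim U"
    using assms(1) open_open_thicken by (intro aff_dim_openin) (auto simp: subspace_imp_affine)
  then have "aff_dim U \<le> aff_dim (U \<inter> thicken u r K)"
    by (metis aff_dim_subset open_thicken_subset_thicken order_refl Int_mono)
  moreover have "aff_dim (U \<inter> thicken u r K) \<le> aff_dim U"
    by (simp add: aff_dim_subset)
  ultimately show ?thesis
    using assms(1) by (simp add: aff_dim_subspace)
qed

lemma face_of_thicken:
  assumes "subspace U" "closed K" "convex K" "K \<noteq> {}"
    and "K \<subseteq> U" "K \<subseteq> ball 0 r" "K \<subseteq> {x. u \<bullet> x = 0}"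
  shows "K face_of (U \<inter> thicken u r K)"
proof -
  have "(U \<inter> thicken u r K \<inter> {x. u \<bullet> x = 0}) face_of (U \<inter> thicken u r K)"
    using assms
    by (intro face_of_Int_supporting_hyperplane_ge convex_Int convex_thicken)
      (auto simp: subspace_imp_convex thicken_def)
  moreover have "U \<inter> thicken u r K \<inter> {x. u \<bullet> x = 0} = K"
    using thicken_Int_hyperplane[of K r u] assms by blast
  ultimately show ?thesis by simp
qed

text \<open>
  A face that leaves the hyperplane at \<open>a\<close> and has a second point \<open>b\<close> contains their midpoint, which
  is a relative interior point by strict convexity; and only the whole set is a face through a
  relative interior point.
\<close>

lemma faces_of_thicken:
  assumes "subspace U" "closed K" "convex K" "K \<noteq> {}"
    and "K \<subseteq> U" "K \<subseteq> ball 0 r" "K \<subseteq> {x. u \<bullet> x = 0}"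
    and F: "F face_of (U \<inter> thicken u r K)"
  shows "F = U \<inter> thicken u r K \<or> F face_of K \<or> (\<exists>x. F = {x})"
proof (cases "F \<subseteq> {x. u \<bullet> x = 0}")
  case True
  then have "F \<subseteq> K"
    using face_of_imp_subset[OF F] thicken_Int_hyperplane[of K r u] assms by blast
  then show ?thesis
    using face_of_subset[OF F] face_of_imp_subset[OF face_of_thicken[OF assms(1-7)]] by blast
next
  case False
  then obtain a where a: "a \<in> F" "u \<bullet> a \<noteq> 0" by blast
  have FC: "F \<subseteq> U \<inter> thicken u r K"
    by (rule face_of_imp_subset[OF F])
  then have a0: "0 < u \<bullet> a" using a by (auto simp: thicken_def)
  show ?thesis
  proof (cases "F = {a}")
    case False
    then obtain b where b: "b \<in> F" "b \<noteq> a" using a by blast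
    have z: "midpoint a b \<in> open_segment a b" using b by simp
    then have "midpoint a b \<in> F"
      using face_of_imp_convex[OF F] a b by (meson convex_contains_open_segment subsetD)
    moreover have "midpoint a b \<in> open_thicken u r K"
      using open_segment_thicken[OF assms(2-4) _ _ a0] a b FC z by blast
    ultimately have "F \<inter> rel_interior (U \<inter> thicken u r K) \<noteq> {}"
      using FC open_thicken_subset_rel_interior[OF assms(1), of u r K] by blast
    then show ?thesis
      using face_of_disjoint_rel_interior[OF F] by blast
  qed blast
qed

section \<open>Prescribing the pattern\<close>

lemma facial_dimension_pattern_thicken:
  assumes "subspace U" "u \<in> U" "u \<noteq> 0" "compact K" "convex K" "K \<noteq> {}"
    and "K \<subseteq> U" "K \<subseteq> ball 0 r" "K \<subseteq> {x. u \<bullet> x = 0}"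
  shows "facial_dimension_pattern (U \<inter> thicken u r K)
       = insert (dim U) (facial_dimension_pattern K)" (is "facial_dimension_pattern ?C = _")
proof -
  have K: "closed K" using \<open>compact K\<close> by (rule compact_imp_closed)
  have dimC: "aff_dim ?C = int (dim U)"
    using assms aff_dim_thicken[of U u _ K r] by fastforce
  have U0: "0 < dim U"
    using assms(2,3) by (metis dim_eq_0 neq0_conv singletonD subsetD)
  have C: "closed ?C" "convex ?C"
    using assms K compact_thicken[of u r K]
    by (auto intro!: closed_Int convex_Int convex_thicken
        simp: closed_subspace subspace_imp_convex compact_imp_closed)
  have KC: "K face_of ?C"
    using assms K by (intro face_of_thicken)
  show ?thesis
  proof (intro set_eqI iffI)
    fix j assume "j \<in> facial_dimension_pattern ?C"
    then obtain F where F: "0 < j" "closed F" "F face_of ?C" "aff_dim F = int j"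
      by (auto simp: facial_dimension_pattern_def)
    then have "F = ?C \<or> F face_of K"
      using faces_of_thicken[OF assms(1) K assms(5-9) F(3)] by auto
    then show "j \<in> insert (dim U) (facial_dimension_pattern K)"
      using F dimC by (auto simp: facial_dimension_pattern_def)
  next
    fix j assume "j \<in> insert (dim U) (facial_dimension_pattern K)"
    then show "j \<in> facial_dimension_pattern ?C"
      using U0 C dimC face_of_refl[OF C(2)] face_of_trans[OF _ KC]
      unfolding facial_dimension_pattern_def by blast
  qed
qed

text \<open>
  The subspace varies in the induction: the largest dimension \<open>b\<close> is the dimension of \<open>U\<close>, and the
  smaller ones are realized in a hyperplane \<open>S\<close> of \<open>U\<close>, whose dimension \<open>b - 1\<close> still bounds them.
\<close>

lemma pattern_realizable_in_subspace:
  fixes T :: "'a::euclidean_space set"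
  assumes "finite D" "subspace T" "D \<subseteq> {1..dim T}"
  obtains C where "compact C" "convex C" "C \<noteq> {}" "C \<subseteq> T" "facial_dimension_pattern C = D"
proof -
  have "\<exists>C\<subseteq>T. compact C \<and> convex C \<and> C \<noteq> {} \<and> facial_dimension_pattern C = D"
    using assms
  proof (induction arbitrary: T rule: finite_linorder_max_induct)
    case empty
    have "aff_dim F \<le> 0" if "F face_of {0::'a}" for F
      using aff_dim_subset[OF face_of_imp_subset[OF that]] by simp
    then have "facial_dimension_pattern {0::'a} = {}"
      by (fastforce simp: facial_dimension_pattern_def)
    then show ?case
      using empty by (intro exI[of _ "{0}"]) (auto simp: subspace_0)
  next
    case (insert b A)
    have b: "0 < b" "b \<le> dim T" using insert.prems by auto
    obtain U where U: "subspace U" "U \<subseteq> span T" "dim U = b"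
      using choose_subspace_of_subspace[OF b(2)] .
    obtain S where S: "subspace S" "S \<subseteq> span U" "dim S = b - 1"
      using choose_subspace_of_subspace[of "b - 1" U] U by auto
    have UT: "U \<subseteq> T" "S \<subseteq> U"
      using U S insert.prems(1) by (auto simp: span_eq_iff[THEN iffD2])
    have "A \<subseteq> {1..dim S}"
      using insert.hyps(2) insert.prems(2) S(3) by fastforce
    then obtain K where K: "K \<subseteq> S" "compact K" "convex K" "K \<noteq> {}"
        "facial_dimension_pattern K = A"
      using insert.IH[OF S(1)] by blast
    have "span S \<subset> span U"
      using UT S U b by (metis span_eq_iff psubsetI less_irrefl diff_less zero_less_one)
    then obtain u where u: "u \<noteq> 0" "u \<in> span U" "\<And>y. y \<in> span S \<Longrightarrow> orthogonal u y"
      using orthogonal_to_subspace_exists_gen by metis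
    have uK: "u \<in> U" "K \<subseteq> {x. u \<bullet> x = 0}"
      using u U(1) K(1) by (auto simp: span_eq_iff[THEN iffD2] orthogonal_def span_base)
    obtain r where r: "K \<subseteq> ball 0 r"
      using bounded_subset_ballD[OF compact_imp_bounded[OF K(2)], of 0] by blast
    let ?C = "U \<inter> thicken u r K"
    have "K \<subseteq> U" using K(1) UT(2) by blast
    have "facial_dimension_pattern ?C = insert b A"
      using facial_dimension_pattern_thicken[OF U(1) uK(1) u(1) K(2-4) \<open>K \<subseteq> U\<close> r uK(2)] U(3) K(5)
      by simp
    moreover have "K \<subseteq> ?C"
      using face_of_imp_subset[OF face_of_thicken[of U K r u]] U(1) K(2-4) \<open>K \<subseteq> U\<close> r uK(2)
      by (simp add: compact_imp_closed)
    moreover have "compact ?C"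
      using U(1) by (intro closed_Int_compact closed_subspace compact_thicken)
    moreover have "convex ?C"
      using U(1) K(2-4)
      by (intro convex_Int convex_thicken) (auto simp: subspace_imp_convex compact_imp_closed)
    ultimately show ?case
      using UT(1) K(4) by (intro exI[of _ ?C]) auto
  qed
  then show thesis using that by blast
qed

theorem theorem1:
  fixes d :: "nat \<Rightarrow> nat" and k :: nat
  assumes "1 \<le> k"
    and "\<forall>i\<in>{1..k}. 0 < d i"
    and "strict_mono_on {1..k} d"
    and "CARD('n::finite) = d k"
  shows "\<exists>C :: (real ^ 'n) set. compact C \<and> convex C \<and>
           facial_dimension_pattern C = d ` {1..k}"
proof -
  have "d i \<le> d k" if "i \<in> {1..k}" for i
    using strict_mono_on_leD[OF assms(3), of i k] that by auto
  then have "d ` {1..k} \<subseteq> {1..dim (UNIV :: (real ^ 'n) set)}"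
    using assms(2,4) by (force simp: Suc_le_eq)
  then obtain C :: "(real ^ 'n) set" where
      "compact C" "convex C" "facial_dimension_pattern C = d ` {1..k}"
    by (rule pattern_realizable_in_subspace[OF finite_imageI[OF finite_atLeastAtMost] subspace_UNIV])
  then show ?thesis by blast
qed

end
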